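(* For $\theta\ne0$ set $\bar\theta:=1/\theta$. (a) Let $\theta\ge1$ and $a\ge0$. Then, for all $n\ge0$, $$p_n^a(\theta)=\frac1{(1+a)^{n+1}}\sum_{k=0}^{n+1}\phi_{n+1-k}(\bar\theta)\,(-a)^{n+1-k}\,\frac{\bar\theta^{k(k-1)/2}}{k!}.$$ (b) Let $\theta<-1$ and $-1/\theta\le a\le-\theta$. Then, for all $n\ge0$, $$p_n^a(\theta)=\left(\frac{-1}{1+a}\right)^{n+1}\sum_{k=0}^{n+1}\phi_{n+1-k}(\bar\theta)\,\frac{\bar\theta^{k(k-1)/2}}{k!}\,(-a)^k.$$
   Context: For $a\in(-1,\infty)$ and $\theta\in\mathbb R$, let $X_1,X_2,\ldots$ be i.i.d. random variables uniformly distributed on $[-a,1]$. Set $p_0^a(\theta):=1$ and, for $n\ge1$, $$p_n^a(\theta):=\mathbb P(X_2\ge\theta X_1,\,X_3\ge\theta X_2,\,\ldots,\,X_{n+1}\ge\theta X_n).$$ For an integer $\ell\ge1$, an $\ell$-profile is a vector $\mathbf r=(r_1,\ldots,r_\ell)$ of integers $r_i\ge0$ with $\sum_{i=1}^\ell i\,r_i=\ell$. Define $\phi_0(\theta):=1$ and, for $\ell\ge1$, $$\phi_\ell(\theta):=\sum_{\ell\text{-profile }\mathbf r}\binom{\sum_{i=1}^\ell r_i}{r_1,\ldots,r_\ell}\prod_{i=1}^\ell\left[\frac{-\theta^{i(i-1)/2}}{i!}\right]^{r_i},$$ where the sum is over all $\ell$-profiles and $\binom{\sum_i r_i}{r_1,\ldots,r_\ell}=\frac{(\sum_i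 r_i)!}{\prod_j r_j!}$ is the multinomial coefficient; $0^0=1$. *)

theory Defs
  imports "HOL-Probability.Probability"
begin

(* The sequence starts at X 1; the value X 0 is irrelevant. *)
definition persistence_prob :: "'b measure \<Rightarrow> (nat \<Rightarrow> 'b \<Rightarrow> real) \<Rightarrow> nat \<Rightarrow> real \<Rightarrow> real" where
  "persistence_prob M X n \<theta> =
     (if n = 0 then 1
      else measure M {\<omega> \<in> space M. \<forall>i\<in>{1..n}. X (Suc i) \<omega> \<ge> \<theta> * X i \<omega>})"

(* A vector (r 1, ..., r l) is a function on nat that vanishes outside {1..l},
   so that distinct functions are distinct vectors. *)
definition profiles :: "nat \<Rightarrow> (nat \<Rightarrow> nat) set" where
  "profiles l = {r. (\<forall>i. i \<notin> {1..l} \<longrightarrow> r i = 0) \<and> (\<Sum>i=1..l. i * r i) = l}"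

definition multinomial :: "nat \<Rightarrow> (nat \<Rightarrow> nat) \<Rightarrow> real" where
  "multinomial l r = fact (\<Sum>i=1..l. r i) / (\<Prod>i=1..l. fact (r i))"

definition phi :: "nat \<Rightarrow> real \<Rightarrow> real" where
  "phi l \<theta> =
     (if l = 0 then 1
      else \<Sum>r\<in>profiles l. multinomial l r *
             (\<Prod>i=1..l. (- (\<theta> ^ (i * (i - 1) div 2)) / fact i) ^ r i))"

(* The sum in phi ranges over a finite set, so it is the genuine one. *)
lemma finite_profiles: "finite (profiles l)"
proof (rule finite_subset)
  show "profiles l \<subseteq> {r. \<forall>i. (i \<in> {1..l} \<longrightarrow> r i \<in> {0..l}) \<and> (i \<notin> {1..l} \<longrightarrow> r i = 0)}"
  proof
    fix r assume r: "r \<in> profiles l"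
    have "r i \<le> l" if i: "i \<in> {1..l}" for i
    proof -
      have "r i \<le> i * r i" using i by simp
      also have "\<dots> \<le> (\<Sum>i=1..l. i * r i)" using i by (intro member_le_sum) auto
      also have "\<dots> = l" using r by (simp add: profiles_def)
      finally show ?thesis .
    qed
    then show "r \<in> {r. \<forall>i. (i \<in> {1..l} \<longrightarrow> r i \<in> {0..l}) \<and> (i \<notin> {1..l} \<longrightarrow> r i = 0)}"
      using r by (auto simp: profiles_def)
  qed
  show "finite {r. \<forall>i::nat. (i \<in> {1..l} \<longrightarrow> r i \<in> {0..l}) \<and> (i \<notin> {1..l} \<longrightarrow> r i = (0::nat))}"
    by (rule finite_set_of_finite_funs) auto
qed

end

theory Submission
  imports Defs
begin

text \<open>
  Write \<open>q = 1 / \<theta>\<close> and \<open>e\<^sub>k = q ^ (k * (k - 1) div 2) / fact k\<close>. Reading off the first part of a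
  composition turns the sum over profiles into a recursion, \<open>phi_convolution\<close>:
  \<open>\<Sum>k\<le>n. phi (n - k) q * e\<^sub>k = 0\<close> for \<open>n \<ge> 1\<close>; that is, \<open>\<Sum>n. phi n q * z ^ n\<close> is the reciprocal of
  \<open>\<Sum>k. e\<^sub>k * z ^ k\<close>.

  Consequently the polynomials
  \<open>H\<^sub>n x = \<Sum>k\<le>n. phi (n - k) q * b ^ (n - k) * e\<^sub>k * x ^ k\<close> (\<open>appell_poly q b n\<close>) satisfy
  \<open>H\<^sub>0 = 1\<close>, \<open>H\<^sub>n b = 0\<close> for \<open>n \<ge> 1\<close>, and \<open>(d / dx) H\<^sub>n\<^sub>+\<^sub>1 x = H\<^sub>n (q * x)\<close>: they are iterated
  integrals starting at \<open>b\<close>.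

  On the probabilistic side, let \<open>P n y\<close> be the probability that the first \<open>n\<close> variables
  satisfy all the inequalities among themselves and that \<open>y\<close> would be an admissible successor
  of \<open>X n\<close>. By independence, \<open>P (n + 1) y\<close> is the integral of \<open>P n x\<close> over those
  \<open>x \<in> [-a, 1]\<close> with \<open>\<theta> * x \<le> y\<close>, divided by \<open>1 + a\<close>. Suppose that
  \<open>y / \<theta> \<in> [-a, 1]\<close>. For \<open>\<theta> > 0\<close> the domain of integration is \<open>[-a, y / \<theta>]\<close>, and for \<open>\<theta> < 0\<close>
  it is \<open>[y / \<theta>, 1]\<close>. The conditions on \<open>a\<close> and \<open>\<theta>\<close> ensure that \<open>x / \<theta>\<close> again lies in
  \<open>[-a, 1]\<close> for every \<open>x \<in> [-a, 1]\<close>, so the recursion closes and \<open>(1 + a) ^ n * P n y\<close> equals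
  \<open>H\<^sub>n (y / \<theta>)\<close> with \<open>b = -a\<close> in the first case and \<open>(-1) ^ n * H\<^sub>n (y / \<theta>)\<close> with \<open>b = 1\<close> in the
  second.

  Finally, the persistence probability is \<open>P (n + 1) y\<close> for any \<open>y\<close> that is almost surely
  an upper bound of \<open>\<theta> * X (n + 1)\<close>; the largest value of \<open>\<theta> * x\<close> on \<open>[-a, 1]\<close> is attained at \<open>x = 1\<close>
  for \<open>\<theta> > 0\<close> and at \<open>x = -a\<close> for \<open>\<theta> < 0\<close>.
\<close>

section \<open>The recursion for the profile sums\<close>

text \<open>
  The coefficients of the series whose reciprocal generates \<open>phi\<close>.
\<close>

definition gauss_coeff :: "real \<Rightarrow> nat \<Rightarrow> real" where
  "gauss_coeff q k = q ^ (k * (k - 1) div 2) / fact k"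

text \<open>
  The contribution of a profile \<open>r\<close> to the sum for general weights \<open>c i\<close> of the parts \<open>i\<close>:
  the number of orderings of the parts times the product of their weights. The upper limit \<open>L\<close>
  of the index range is separate from the number that is composed, so that profiles of
  different numbers can be compared over a common range.
\<close>

definition profile_weight :: "(nat \<Rightarrow> real) \<Rightarrow> nat \<Rightarrow> (nat \<Rightarrow> nat) \<Rightarrow> real" where
  "profile_weight c L r = fact (\<Sum>i=1..L. r i) * (\<Prod>i=1..L. c i ^ r i / fact (r i))"

lemma profiles_iff:
  assumes "l \<le> L"
  shows "r \<in> profiles l \<longleftrightarrow> (\<forall>i. i \<notin> {1..L} \<longrightarrow> r i = 0) \<and> (\<Sum>i=1..L. i * r i) = l"
proof -
  have restrict: "(\<Sum>i=1..L. i * r i) = (\<Sum>i=1..l. i * r i)" if "\<forall>i. i \<notin> {1..l} \<longrightarrow> r i = 0"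
    by (rule sum.mono_neutral_right) (use that assms in simp_all)
  show ?thesis
  proof
    assume r: "r \<in> profiles l"
    then have supp: "\<forall>i. i \<notin> {1..l} \<longrightarrow> r i = 0" by (simp add: profiles_def)
    have "{1..l} \<subseteq> {1..L}" using assms by simp
    with supp have "\<forall>i. i \<notin> {1..L} \<longrightarrow> r i = 0" by blast
    moreover have "(\<Sum>i=1..L. i * r i) = l"
      unfolding restrict[OF supp] using r by (simp add: profiles_def)
    ultimately show "(\<forall>i. i \<notin> {1..L} \<longrightarrow> r i = 0) \<and> (\<Sum>i=1..L. i * r i) = l" ..
  next
    assume "(\<forall>i. i \<notin> {1..L} \<longrightarrow> r i = 0) \<and> (\<Sum>i=1..L. i * r i) = l"
    then have zero: "\<And>i. i \<notin> {1..L} \<Longrightarrow> r i = 0" and r: "(\<Sum>i=1..L. i * r i) = l" by blast+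
    have "r i = 0" if "i \<notin> {1..l}" for i
    proof (rule ccontr)
      assume ri: "r i \<noteq> 0"
      with zero[of i] have i: "i \<in> {1..L}" by argo
      have "i \<le> i * r i" using ri by simp
      also have "\<dots> \<le> (\<Sum>i=1..L. i * r i)" using i by (intro member_le_sum) auto
      finally show False using that i r by simp
    qed
    then have supp: "\<forall>i. i \<notin> {1..l} \<longrightarrow> r i = 0" by blast
    moreover have "(\<Sum>i=1..l. i * r i) = l"
      unfolding restrict[OF supp, symmetric] by (rule r)
    ultimately show "r \<in> profiles l" by (simp add: profiles_def)
  qed
qed

lemma profile_weight_extend:
  assumes "r \<in> profiles l" "l \<le> L"
  shows "profile_weight c L r = profile_weight c l r"
proof -
  have supp: "r i = 0" if "i \<in> {1..L} - {1..l}" for i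
    using assms(1) that by (simp add: profiles_def)
  have "(\<Sum>i=1..L. r i) = (\<Sum>i=1..l. r i)"
    by (rule sum.mono_neutral_right) (use assms(2) supp in simp_all)
  moreover have "(\<Prod>i=1..L. c i ^ r i / fact (r i)) = (\<Prod>i=1..l. c i ^ r i / fact (r i))"
    by (rule prod.mono_neutral_right) (use assms(2) supp in simp_all)
  ultimately show ?thesis by (simp add: profile_weight_def)
qed

text \<open>
  Splitting the orderings of a multiset of parts by their first part \<open>i\<close>. Algebraically, the
  \<open>i\<close>-th summand is \<open>r i / N\<close> times the left-hand side, where \<open>N\<close> is the number of parts.
\<close>

lemma profile_weight_rec:
  assumes pos: "(\<Sum>i=1..L. r i) > 0"
  shows "profile_weight c L r = (\<Sum>i=1..L. if r i = 0 then 0 else c i * profile_weight c L (r(i := r i - 1)))"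
proof -
  define N where "N = (\<Sum>i=1..L. r i)"
  define P where "P = (\<Prod>i=1..L. c i ^ r i / fact (r i))"
  have summand: "(if r i = 0 then 0 else c i * profile_weight c L (r(i := r i - 1)))
      = real (r i) * (fact (N - 1) * P)" if i: "i \<in> {1..L}" for i
  proof (cases "r i")
    case 0 then show ?thesis by simp
  next
    case (Suc m)
    let ?s = "r(i := r i - 1)"
    let ?Q = "\<Prod>j\<in>{1..L} - {i}. c j ^ r j / fact (r j)"
    have rest: "(\<Sum>j\<in>{1..L} - {i}. ?s j) = (\<Sum>j\<in>{1..L} - {i}. r j)"
      "(\<Prod>j\<in>{1..L} - {i}. c j ^ ?s j / fact (?s j)) = ?Q"
      by (auto intro!: sum.cong prod.cong)
    have "(\<Sum>j=1..L. ?s j) = N - 1"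
      unfolding N_def sum.remove[OF finite_atLeastAtMost i] rest(1) using Suc by simp
    moreover have "(\<Prod>j=1..L. c j ^ ?s j / fact (?s j)) = c i ^ m / fact m * ?Q"
      unfolding prod.remove[OF finite_atLeastAtMost i] rest(2) using Suc by simp
    moreover have "P = c i ^ Suc m / fact (Suc m) * ?Q"
      unfolding P_def prod.remove[OF finite_atLeastAtMost i] Suc ..
    ultimately have less: "profile_weight c L ?s = fact (N - 1) * (c i ^ m / fact m * ?Q)"
      and P: "P = c i ^ Suc m / fact (Suc m) * ?Q"
      by (simp_all only: profile_weight_def)
    have step: "c i * (c i ^ m / fact m * ?Q) = real (Suc m) * P"
      unfolding P by (simp add: field_simps del: of_nat_Suc)
    have "c i * profile_weight c L ?s = fact (N - 1) * (c i * (c i ^ m / fact m * ?Q))"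
      unfolding less by (rule mult.left_commute)
    also have "\<dots> = real (Suc m) * (fact (N - 1) * P)"
      unfolding step by (rule mult.left_commute)
    finally have "c i * profile_weight c L ?s = real (Suc m) * (fact (N - 1) * P)" .
    then show ?thesis using Suc by simp
  qed
  have "(\<Sum>i=1..L. if r i = 0 then 0 else c i * profile_weight c L (r(i := r i - 1)))
      = real N * (fact (N - 1) * P)"
    using summand by (simp add: N_def sum_distrib_right)
  also have "\<dots> = profile_weight c L r"
    using pos fact_reduce[of N, where ?'a = real] by (simp add: profile_weight_def N_def P_def)
  finally show ?thesis by simp
qed

text \<open>
  Removing the first part \<open>i\<close> of a composition of \<open>l\<close> leaves a composition of \<open>l - i\<close>.
\<close>

lemma sum_profiles_rec:
  assumes "l \<ge> 1"
  shows "(\<Sum>r\<in>profiles l. profile_weight c l r) = (\<Sum>i=1..l. c i * (\<Sum>s\<in>profiles (l - i). profile_weight c (l - i) s))"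
proof -
  have shift: "(\<Sum>r\<in>profiles l. if r i = 0 then 0 else c i * profile_weight c l (r(i := r i - 1)))
      = c i * (\<Sum>s\<in>profiles (l - i). profile_weight c (l - i) s)" if i: "i \<in> {1..l}" for i
  proof -
    have up: "s(i := s i + 1) \<in> profiles l" if "s \<in> profiles (l - i)" for s
    proof -
      have "(\<Sum>j=1..l. j * (s(i := s i + 1)) j) = (\<Sum>j=1..l. j * s j) + i"
        unfolding sum.remove[OF finite_atLeastAtMost i]
        by (simp add: algebra_simps)
      then show ?thesis
        using that i by (auto simp: profiles_iff[of "l - i" l] profiles_iff[of l l])
    qed
    have down: "r(i := r i - 1) \<in> profiles (l - i)" if "r \<in> profiles l" "r i \<noteq> 0" for r
    proof -
      have "(\<Sum>j=1..l. j * r j) = (\<Sum>j=1..l. j * (r(i := r i - 1)) j) + i"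
        unfolding sum.remove[OF finite_atLeastAtMost i]
        using that(2) by (cases "r i") (simp_all add: algebra_simps)
      then show ?thesis
        using that i by (auto simp: profiles_iff[of "l - i" l] profiles_iff[of l l])
    qed
    have "(\<Sum>r\<in>profiles l. if r i = 0 then 0 else c i * profile_weight c l (r(i := r i - 1)))
        = (\<Sum>r\<in>{r \<in> profiles l. r i \<noteq> 0}. c i * profile_weight c l (r(i := r i - 1)))"
      by (intro sum.mono_neutral_cong_right finite_profiles) auto
    also have "\<dots> = (\<Sum>s\<in>profiles (l - i). c i * profile_weight c (l - i) s)"
      using up down by (intro sum.reindex_bij_witness[of _ "\<lambda>s. s(i := s i + 1)" "\<lambda>r. r(i := r i - 1)"])
        (auto simp: profile_weight_extend[of _ "l - i" l])
    finally show ?thesis by (simp add: sum_distrib_left)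
  qed
  have "(\<Sum>r\<in>profiles l. profile_weight c l r)
      = (\<Sum>r\<in>profiles l. \<Sum>i=1..l. if r i = 0 then 0 else c i * profile_weight c l (r(i := r i - 1)))"
  proof (intro sum.cong refl profile_weight_rec)
    fix r assume "r \<in> profiles l"
    then have "(\<Sum>i=1..l. i * r i) \<noteq> 0"
      using assms by (simp add: profiles_def)
    moreover have "(\<Sum>i=1..l. i * r i) = 0" if "(\<Sum>i=1..l. r i) = 0"
    proof (rule sum.neutral, rule ballI)
      fix i assume "i \<in> {1..l}"
      with that have "r i = 0" by (simp only: sum_eq_0_iff finite_atLeastAtMost)
      then show "i * r i = 0" by simp
    qed
    ultimately show "(\<Sum>i=1..l. r i) > 0" by (metis gr0I)
  qed
  also have "\<dots> = (\<Sum>i=1..l. c i * (\<Sum>s\<in>profiles (l - i). profile_weight c (l - i) s))"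
    by (subst sum.swap) (intro sum.cong refl shift)
  finally show ?thesis .
qed

lemma phi_eq_sum_profile_weight: "phi l q = (\<Sum>r\<in>profiles l. profile_weight (\<lambda>i. - gauss_coeff q i) l r)"
proof (cases "l = 0")
  case True
  have "profiles 0 = {\<lambda>_. 0}" by (auto simp: profiles_def)
  then show ?thesis using True by (simp add: phi_def profile_weight_def)
next
  case False
  then show ?thesis
    by (auto simp: phi_def profile_weight_def multinomial_def gauss_coeff_def prod_dividef intro!: sum.cong)
qed

lemma phi_convolution:
  assumes "n \<ge> 1"
  shows "(\<Sum>k=0..n. phi (n - k) q * gauss_coeff q k) = 0"
proof -
  have "phi n q = (\<Sum>k=1..n. - gauss_coeff q k * phi (n - k) q)"
    using sum_profiles_rec[OF assms] by (simp only: phi_eq_sum_profile_weight)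
  moreover have "(\<Sum>k=0..n. phi (n - k) q * gauss_coeff q k)
      = phi n q + (\<Sum>k=1..n. phi (n - k) q * gauss_coeff q k)"
    by (simp add: sum.atLeast_Suc_atMost gauss_coeff_def)
  ultimately show ?thesis by (simp add: sum_negf mult.commute)
qed

section \<open>Iterated integrals\<close>

text \<open>
  A \<open>q\<close>-analogue of an Appell sequence: differentiation lowers the degree by one and rescales
  the argument by \<open>q\<close>, and the constants of integration are fixed by a zero at \<open>b\<close>.
\<close>

definition appell_poly :: "real \<Rightarrow> real \<Rightarrow> nat \<Rightarrow> real \<Rightarrow> real" where
  "appell_poly q b n x = (\<Sum>k=0..n. phi (n - k) q * b ^ (n - k) * gauss_coeff q k * x ^ k)"

lemma gauss_coeff_Suc: "real (Suc k) * gauss_coeff q (Suc k) = q ^ k * gauss_coeff q k"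
proof -
  have "Suc k * k div 2 = k + k * (k - 1) div 2"
    by (cases k) (auto simp: algebra_simps)
  then show ?thesis
    by (simp add: gauss_coeff_def power_add del: of_nat_Suc mult_Suc)
qed

lemma appell_poly_root:
  assumes "n \<ge> 1"
  shows "appell_poly q b n b = 0"
proof -
  have "appell_poly q b n b = (\<Sum>k=0..n. b ^ n * (phi (n - k) q * gauss_coeff q k))"
    unfolding appell_poly_def by (intro sum.cong refl) (auto simp: power_add[symmetric] mult_ac)
  then show ?thesis
    using phi_convolution[OF assms] by (simp add: sum_distrib_left[symmetric])
qed

lemma appell_poly_deriv: "(appell_poly q b (Suc n) has_real_derivative appell_poly q b n (q * x)) (at x)"
proof -
  have "appell_poly q b (Suc n) = (\<lambda>x. phi (Suc n) q * b ^ Suc n * gauss_coeff q 0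
      + (\<Sum>k=0..n. phi (n - k) q * b ^ (n - k) * gauss_coeff q (Suc k) * x ^ Suc k))"
    unfolding appell_poly_def by (subst sum.atLeast0_atMost_Suc_shift) simp
  moreover have "((\<lambda>x. phi (Suc n) q * b ^ Suc n * gauss_coeff q 0
      + (\<Sum>k=0..n. phi (n - k) q * b ^ (n - k) * gauss_coeff q (Suc k) * x ^ Suc k)) has_real_derivative
      (\<Sum>k=0..n. phi (n - k) q * b ^ (n - k) * (real (Suc k) * gauss_coeff q (Suc k)) * x ^ k)) (at x)"
    by (auto intro!: derivative_eq_intros sum.cong simp del: power_Suc)
  moreover have "(\<Sum>k=0..n. phi (n - k) q * b ^ (n - k) * (real (Suc k) * gauss_coeff q (Suc k)) * x ^ k)
      = appell_poly q b n (q * x)"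
    unfolding appell_poly_def gauss_coeff_Suc by (auto intro!: sum.cong simp: power_mult_distrib)
  ultimately show ?thesis by metis
qed

lemma appell_poly_integral:
  assumes "u \<le> v"
  shows "(\<integral>x. appell_poly q b n (q * x) * indicator {u..v} x \<partial>lborel) = appell_poly q b (Suc n) v - appell_poly q b (Suc n) u"
  using assms
proof (rule integral_FTC_Icc_real)
  show "(appell_poly q b (Suc n) has_real_derivative appell_poly q b n (q * x)) (at x)" for x
    by (rule appell_poly_deriv)
  show "isCont (\<lambda>x. appell_poly q b n (q * x)) x" for x
    unfolding appell_poly_def by (intro continuous_intros)
qed

section \<open>Conditioning on the last variable\<close>

text \<open>
  For independent \<open>Y\<close> and \<open>Z\<close>, the probability of an event about \<open>(Y, Z)\<close> is obtained by
  freezing \<open>Z\<close> and averaging. The second part provides the measurability in the frozen value,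
  stated through a function \<open>g\<close> because only the values on \<open>space T\<close> matter.
\<close>

lemma (in prob_space) prob_indep_pair:
  assumes ind: "indep_var S Y T Z" and Q: "Q \<in> sets (S \<Otimes>\<^sub>M T)"
  shows "prob {\<omega> \<in> space M. (Y \<omega>, Z \<omega>) \<in> Q} = (\<integral>\<omega>. prob {\<omega>' \<in> space M. (Y \<omega>', Z \<omega>) \<in> Q} \<partial>M)"
    and "\<exists>g. g \<in> borel_measurable T \<and>
      (\<forall>z\<in>space T. g z = prob {\<omega>' \<in> space M. (Y \<omega>', z) \<in> Q})"
proof -
  have Y[measurable]: "random_variable S Y" and Z[measurable]: "random_variable T Z"
    and joint: "distr M S Y \<Otimes>\<^sub>M distr M T Z = distr M (S \<Otimes>\<^sub>M T) (\<lambda>\<omega>. (Y \<omega>, Z \<omega>))"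
    using ind by (simp_all add: indep_var_distribution_eq)
  interpret DY: prob_space "distr M S Y" by (rule prob_space_distr) (rule Y)
  interpret DZ: prob_space "distr M T Z" by (rule prob_space_distr) (rule Z)
  interpret P: pair_prob_space "distr M S Y" "distr M T Z" ..
  define f where "f z = emeasure (distr M S Y) ((\<lambda>y. (y, z)) -` Q)" for z
  have f_meas[measurable]: "f \<in> borel_measurable T"
    using P.measurable_emeasure_Pair2[of Q] Q unfolding f_def
    by (simp add: sets_pair_measure_cong[of "distr M S Y" S "distr M T Z" T])
  have f_eq: "f z = emeasure M {\<omega>' \<in> space M. (Y \<omega>', z) \<in> Q}" if "z \<in> space T" for z
  proof -
    have "(\<lambda>y. (y, z)) -` Q \<in> sets S" using Q by (rule sets_Pair2)
    then show ?thesis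
      by (auto simp: f_def emeasure_distr intro!: arg_cong[where f = "emeasure M"])
  qed
  have "(\<lambda>z. enn2real (f z)) \<in> borel_measurable T" by measurable
  with f_eq show "\<exists>g. g \<in> borel_measurable T \<and>
      (\<forall>z\<in>space T. g z = prob {\<omega>' \<in> space M. (Y \<omega>', z) \<in> Q})"
    by (intro exI[of _ "\<lambda>z. enn2real (f z)"]) (auto simp: measure_def)
  have f_fin: "f z < \<top>" for z
    unfolding f_def using DY.emeasure_finite less_top by blast
  have "emeasure M {\<omega> \<in> space M. (Y \<omega>, Z \<omega>) \<in> Q}
      = emeasure (distr M (S \<Otimes>\<^sub>M T) (\<lambda>\<omega>. (Y \<omega>, Z \<omega>))) Q"
    using Q by (auto simp: emeasure_distr intro!: arg_cong[where f = "emeasure M"])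
  also have "\<dots> = (\<integral>\<^sup>+z. f z \<partial>distr M T Z)"
    unfolding joint[symmetric] f_def
    using Q by (intro P.emeasure_pair_measure_alt2)
      (simp add: sets_pair_measure_cong[of "distr M S Y" S "distr M T Z" T])
  also have "\<dots> = (\<integral>\<^sup>+\<omega>. f (Z \<omega>) \<partial>M)"
    by (rule nn_integral_distr) auto
  finally have "prob {\<omega> \<in> space M. (Y \<omega>, Z \<omega>) \<in> Q} = enn2real (\<integral>\<^sup>+\<omega>. f (Z \<omega>) \<partial>M)"
    by (simp add: measure_def)
  also have "\<dots> = (\<integral>\<omega>. enn2real (f (Z \<omega>)) \<partial>M)"
    using f_fin by (subst integral_eq_nn_integral) (auto simp: ennreal_enn2real)
  also have "\<dots> = (\<integral>\<omega>. prob {\<omega>' \<in> space M. (Y \<omega>', Z \<omega>) \<in> Q} \<partial>M)"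
    using measurable_space[OF Z] by (intro Bochner_Integration.integral_cong) (auto simp: f_eq measure_def)
  finally show "prob {\<omega> \<in> space M. (Y \<omega>, Z \<omega>) \<in> Q} = (\<integral>\<omega>. prob {\<omega>' \<in> space M. (Y \<omega>', Z \<omega>) \<in> Q} \<partial>M)" .
qed

text \<open>
  The first \<open>n\<close> variables satisfy the inequalities among themselves, and \<open>y\<close> is an admissible
  successor of \<open>X n\<close>. For \<open>n = 0\<close> there is no condition.
\<close>

definition survival_event :: "'b measure \<Rightarrow> (nat \<Rightarrow> 'b \<Rightarrow> real) \<Rightarrow> real \<Rightarrow> nat \<Rightarrow> real \<Rightarrow> 'b set" where
  "survival_event M X \<theta> n y =
     {\<omega> \<in> space M. \<forall>i\<in>{1..n}. \<theta> * X i \<omega> \<le> (if i = n then y else X (Suc i) \<omega>)}"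

text \<open>
  The one-step recursion: the value \<open>x\<close> of the last variable is integrated out, and it serves
  as the successor in the event about the variables before it.
\<close>

lemma (in prob_space) prob_survival_event_Suc:
  assumes ind: "indep_vars (\<lambda>_. borel) X {1..}"
    and dist: "distributed M lborel (X (Suc n)) (\<lambda>x. ennreal (f x))"
    and f: "\<And>x. 0 \<le> f x"
  shows "prob (survival_event M X \<theta> (Suc n) y) =
     (\<integral>x. f x * (indicator {x. \<theta> * x \<le> y} x * prob (survival_event M X \<theta> n x)) \<partial>lborel)"
proof -
  define Y where "Y \<omega> = restrict (\<lambda>i. X i \<omega>) {1..n}" for \<omega>
  \<comment> \<open>\<open>indep_var\<close> needs two random elements of one type, hence a vector with a single entry.\<close>
  define Z where "Z \<omega> = restrict (\<lambda>i. X i \<omega>) {Suc n}" for \<omega>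
  let ?S = "PiM {1..n} (\<lambda>_. borel :: real measure)"
  let ?T = "PiM {Suc n} (\<lambda>_. borel :: real measure)"
  have ind2: "indep_var ?S Y ?T Z"
    unfolding Y_def[abs_def] Z_def[abs_def] by (rule indep_var_restrict[OF ind]) auto
  define Q where "Q = {p \<in> space (?S \<Otimes>\<^sub>M ?T). \<theta> * snd p (Suc n) \<le> y \<and>
    (\<forall>i\<in>{1..n}. \<theta> * fst p i \<le> (if i = n then snd p (Suc n) else fst p (Suc i)))}"
  have Q: "Q \<in> sets (?S \<Otimes>\<^sub>M ?T)"
  proof -
    have first: "(\<lambda>p. fst p i) \<in> borel_measurable (?S \<Otimes>\<^sub>M ?T)" if "i \<in> {1..n}" for i
      by (rule measurable_compose[OF measurable_fst measurable_component_singleton[OF that]])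
    have last: "(\<lambda>p. snd p (Suc n)) \<in> borel_measurable (?S \<Otimes>\<^sub>M ?T)"
      by (rule measurable_compose[OF measurable_snd measurable_component_singleton]) simp
    have "{p \<in> space (?S \<Otimes>\<^sub>M ?T). \<theta> * fst p i \<le> (if i = n then snd p (Suc n) else fst p (Suc i))}
        \<in> sets (?S \<Otimes>\<^sub>M ?T)" if i: "i \<in> {1..n}" for i
    proof (cases "i = n")
      case True
      then show ?thesis
        using borel_measurable_le[OF borel_measurable_times[OF borel_measurable_const first[OF i]] last]
        by simp
    next
      case False
      with i have "Suc i \<in> {1..n}" by simp
      then show ?thesis
        using False borel_measurable_le[OF borel_measurable_times[OF borel_measurable_const first[OF i]] first[of "Suc i"]]
        by simp
    qed
    then have "{p \<in> space (?S \<Otimes>\<^sub>M ?T).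
          \<forall>i\<in>{1..n}. \<theta> * fst p i \<le> (if i = n then snd p (Suc n) else fst p (Suc i))}
        \<in> sets (?S \<Otimes>\<^sub>M ?T)"
      by (rule sets.sets_Collect_finite_All) simp_all
    moreover have "{p \<in> space (?S \<Otimes>\<^sub>M ?T). \<theta> * snd p (Suc n) \<le> y} \<in> sets (?S \<Otimes>\<^sub>M ?T)"
      by (rule borel_measurable_le[OF borel_measurable_times[OF borel_measurable_const last] borel_measurable_const])
    ultimately show ?thesis unfolding Q_def by (rule sets.sets_Collect_conj)
  qed
  have Yspace: "Y \<omega> \<in> space ?S" and Zspace: "Z \<omega> \<in> space ?T" for \<omega>
    by (auto simp: Y_def Z_def space_PiM)
  define h where "h x = indicator {x. \<theta> * x \<le> y} x * prob (survival_event M X \<theta> n x)" for x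
  have slice: "prob {\<omega>' \<in> space M. (Y \<omega>', z) \<in> Q} = h (z (Suc n))" if z: "z \<in> space ?T" for z
  proof (cases "\<theta> * z (Suc n) \<le> y")
    case True
    have "(Y \<omega>', z) \<in> Q \<longleftrightarrow>
        (\<forall>i\<in>{1..n}. \<theta> * X i \<omega>' \<le> (if i = n then z (Suc n) else X (Suc i) \<omega>'))" for \<omega>'
    proof -
      have "(Y \<omega>', z) \<in> Q \<longleftrightarrow>
          (\<forall>i\<in>{1..n}. \<theta> * Y \<omega>' i \<le> (if i = n then z (Suc n) else Y \<omega>' (Suc i)))"
        using True Yspace[of \<omega>'] z by (simp add: Q_def space_pair_measure)
      also have "\<dots> \<longleftrightarrow> (\<forall>i\<in>{1..n}. \<theta> * X i \<omega>' \<le> (if i = n then z (Suc n) else X (Suc i) \<omega>'))"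
        by (rule ball_cong) (simp_all add: Y_def)
      finally show ?thesis .
    qed
    then have "{\<omega>' \<in> space M. (Y \<omega>', z) \<in> Q} = survival_event M X \<theta> n (z (Suc n))"
      by (simp add: survival_event_def)
    then show ?thesis using True by (simp add: h_def)
  next
    case False
    then show ?thesis by (simp add: Q_def h_def)
  qed
  have "survival_event M X \<theta> (Suc n) y = {\<omega> \<in> space M. (Y \<omega>, Z \<omega>) \<in> Q}"
  proof -
    have "(Y \<omega>, Z \<omega>) \<in> Q \<longleftrightarrow> \<theta> * X (Suc n) \<omega> \<le> y \<and> (\<forall>i\<in>{1..n}. \<theta> * X i \<omega> \<le> X (Suc i) \<omega>)" for \<omega>
    proof -
      have "(Y \<omega>, Z \<omega>) \<in> space (?S \<Otimes>\<^sub>M ?T)"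
        using Yspace Zspace by (simp add: space_pair_measure)
      then have "(Y \<omega>, Z \<omega>) \<in> Q \<longleftrightarrow> \<theta> * Z \<omega> (Suc n) \<le> y \<and>
          (\<forall>i\<in>{1..n}. \<theta> * Y \<omega> i \<le> (if i = n then Z \<omega> (Suc n) else Y \<omega> (Suc i)))"
        by (simp only: Q_def mem_Collect_eq fst_conv snd_conv simp_thms)
      also have "(\<forall>i\<in>{1..n}. \<theta> * Y \<omega> i \<le> (if i = n then Z \<omega> (Suc n) else Y \<omega> (Suc i)))
          \<longleftrightarrow> (\<forall>i\<in>{1..n}. \<theta> * X i \<omega> \<le> X (Suc i) \<omega>)"
        by (rule ball_cong) (simp_all add: Y_def Z_def)
      also have "Z \<omega> (Suc n) = X (Suc n) \<omega>" by (simp add: Z_def)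
      finally show ?thesis .
    qed
    then show ?thesis
      by (simp add: survival_event_def atLeastAtMostSuc_conv cong: conj_cong)
  qed
  then have "prob (survival_event M X \<theta> (Suc n) y)
      = (\<integral>\<omega>. prob {\<omega>' \<in> space M. (Y \<omega>', Z \<omega>) \<in> Q} \<partial>M)"
    using prob_indep_pair(1)[OF ind2 Q] by simp
  also have "\<dots> = (\<integral>\<omega>. h (X (Suc n) \<omega>) \<partial>M)"
    using slice[OF Zspace] by (simp add: Z_def)
  also have "\<dots> = (\<integral>x. f x * h x \<partial>lborel)"
  proof -
    obtain g where g: "g \<in> borel_measurable ?T"
        "\<And>z. z \<in> space ?T \<Longrightarrow> g z = prob {\<omega>' \<in> space M. (Y \<omega>', z) \<in> Q}"
      using prob_indep_pair(2)[OF ind2 Q] by blast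
    have emb: "(\<lambda>x. restrict (\<lambda>_. x) {Suc n}) \<in> measurable borel ?T"
      by (intro measurable_restrict) simp
    have "h = (\<lambda>x. g (restrict (\<lambda>_. x) {Suc n}))"
    proof
      fix x :: real
      have z: "restrict (\<lambda>_. x) {Suc n} \<in> space ?T" by (simp add: space_PiM)
      show "h x = g (restrict (\<lambda>_. x) {Suc n})"
        unfolding g(2)[OF z] slice[OF z] by simp
    qed
    then have "h \<in> borel_measurable lborel"
      using measurable_compose[OF emb g(1)] by simp
    then show ?thesis
      by (rule distributed_integral[OF dist _ f, symmetric])
  qed
  finally show ?thesis unfolding h_def .
qed

text \<open>
  If \<open>\<theta> * X (n + 1) \<le> y\<close> almost surely, then the last condition of the survival event is void.
\<close>

lemma (in prob_space) persistence_prob_eq_survival: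
  assumes ind: "indep_vars (\<lambda>_. borel) X {1..}"
    and bound: "AE \<omega> in M. \<theta> * X (Suc n) \<omega> \<le> y"
  shows "persistence_prob M X n \<theta> = prob (survival_event M X \<theta> (Suc n) y)"
proof -
  have X: "X i \<in> borel_measurable M" if "i \<ge> 1" for i
    using ind that by (auto simp: indep_vars_def)
  let ?A = "{\<omega> \<in> space M. \<forall>i\<in>{1..n}. \<theta> * X i \<omega> \<le> X (Suc i) \<omega>}"
  have "?A \<in> sets M"
    using X by (intro sets.sets_Collect_finite_All borel_measurable_le borel_measurable_times) auto
  moreover have last: "{\<omega> \<in> space M. \<theta> * X (Suc n) \<omega> \<le> y} \<in> sets M"
    using X[of "Suc n"] by simp
  moreover have split: "survival_event M X \<theta> (Suc n) y = ?A \<inter> {\<omega> \<in> space M. \<theta> * X (Suc n) \<omega> \<le> y}"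
    by (auto simp: survival_event_def atLeastAtMostSuc_conv)
  moreover have "prob ?A = prob (?A \<inter> {\<omega> \<in> space M. \<theta> * X (Suc n) \<omega> \<le> y})"
    using calculation bound by (intro measure_eq_AE) auto
  moreover have "persistence_prob M X n \<theta> = prob ?A"
    by (cases "n = 0") (auto simp: persistence_prob_def prob_space)
  ultimately show ?thesis by simp
qed

section \<open>Uniform variables\<close>

text \<open>
  Independent random variables \<open>X 1, X 2, \<dots>\<close>, each uniformly distributed on \<open>[-a, 1]\<close>; the
  normalising factor is \<open>measure lborel {- a..1} = 1 + a > 0\<close>.
\<close>

locale uniform_sequence = prob_space M for M :: "'b measure" +
  fixes X :: "nat \<Rightarrow> 'b \<Rightarrow> real" and a :: real
  assumes minus_one_less: "- 1 < a"
    and indep: "indep_vars (\<lambda>_. borel) X {1..}"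
    and uniform: "1 \<le> i \<Longrightarrow>
      distributed M lborel (X i) (\<lambda>x. indicator {- a..1} x / measure lborel {- a..1})"
begin

lemma AE_bounds:
  assumes "1 \<le> i"
  shows "AE \<omega> in M. - a \<le> X i \<omega> \<and> X i \<omega> \<le> 1"
proof -
  have "X i \<in> measurable M lborel"
    using uniform[OF assms] by (rule distributed_measurable)
  moreover have "AE x in distr M lborel (X i). - a \<le> x \<and> x \<le> 1"
    unfolding distributed_distr_eq_density[OF uniform[OF assms]]
    by (subst AE_density) (auto simp: indicator_def)
  ultimately show ?thesis by (rule AE_distrD)
qed

lemma prob_survival_Suc:
  "prob (survival_event M X \<theta> (Suc n) y) =
     (\<integral>x. indicator {- a..1} x * (indicator {x. \<theta> * x \<le> y} x * prob (survival_event M X \<theta> n x)) \<partial>lborel) / (1 + a)"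
proof -
  have "prob (survival_event M X \<theta> (Suc n) y) =
     (\<integral>x. indicator {- a..1} x / measure lborel {- a..1} *
        (indicator {x. \<theta> * x \<le> y} x * prob (survival_event M X \<theta> n x)) \<partial>lborel)"
    by (rule prob_survival_event_Suc[OF indep]) (use uniform in auto)
  then show ?thesis using minus_one_less by (simp add: add.commute)
qed

text \<open>
  Here \<open>x / \<theta>\<close> stays in \<open>[-a, 1]\<close> for \<open>x\<close> in \<open>[-a, 1]\<close>, and \<open>\<theta> * x \<le> y\<close> means
  \<open>x \<le> y / \<theta>\<close>.
\<close>

lemma prob_survival_pos:
  assumes th: "1 \<le> \<theta>" and a0: "0 \<le> a" and y: "- a \<le> y / \<theta>" "y / \<theta> \<le> 1"
  shows "prob (survival_event M X \<theta> n y) = appell_poly (1 / \<theta>) (- a) n (y / \<theta>) / (1 + a) ^ n"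
  using y
proof (induction n arbitrary: y)
  case 0
  then show ?case by (simp add: survival_event_def prob_space appell_poly_def phi_def gauss_coeff_def)
next
  case (Suc n)
  have "indicator {- a..1} x * (indicator {x. \<theta> * x \<le> y} x * prob (survival_event M X \<theta> n x))
      = appell_poly (1 / \<theta>) (- a) n (1 / \<theta> * x) * indicator {- a..y / \<theta>} x / (1 + a) ^ n" for x
  proof (cases "x \<in> {- a..1}")
    case True
    have "a * 1 \<le> a * \<theta>" using th a0 by (intro mult_left_mono) auto
    then have "- a \<le> x / \<theta>" "x / \<theta> \<le> 1"
      using th True by (simp_all add: field_simps)
    then have "prob (survival_event M X \<theta> n x) = appell_poly (1 / \<theta>) (- a) n (x / \<theta>) / (1 + a) ^ n"
      by (rule Suc.IH)
    moreover have "\<theta> * x \<le> y \<longleftrightarrow> x \<le> y / \<theta>"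
      using th by (simp add: field_simps)
    ultimately show ?thesis using True by (simp add: indicator_def)
  next
    case False
    then show ?thesis using Suc.prems by (auto simp: indicator_def)
  qed
  then show ?case
    using appell_poly_integral[OF Suc.prems(1), of "1 / \<theta>" "- a" n] appell_poly_root[of "Suc n"]
    by (simp add: prob_survival_Suc mult.commute)
qed

text \<open>
  Division by \<open>\<theta>\<close> reverses the order: \<open>x / \<theta>\<close> lies between \<open>1 / \<theta> \<ge> - a\<close> and
  \<open>- a / \<theta> \<le> 1\<close>, and \<open>\<theta> * x \<le> y\<close> means \<open>y / \<theta> \<le> x\<close>. Integrating from a variable lower limit
  yields one sign per step.
\<close>

lemma prob_survival_neg:
  assumes th: "\<theta> < - 1" and a1: "- 1 / \<theta> \<le> a" "a \<le> - \<theta>" and y: "- a \<le> y / \<theta>" "y / \<theta> \<le> 1"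
  shows "prob (survival_event M X \<theta> n y) = (- 1) ^ n * appell_poly (1 / \<theta>) 1 n (y / \<theta>) / (1 + a) ^ n"
  using y
proof (induction n arbitrary: y)
  case 0
  then show ?case by (simp add: survival_event_def prob_space appell_poly_def phi_def gauss_coeff_def)
next
  case (Suc n)
  have "indicator {- a..1} x * (indicator {x. \<theta> * x \<le> y} x * prob (survival_event M X \<theta> n x))
      = appell_poly (1 / \<theta>) 1 n (1 / \<theta> * x) * indicator {y / \<theta>..1} x * ((- 1) ^ n / (1 + a) ^ n)" for x
  proof (cases "x \<in> {- a..1}")
    case True
    have "- (a * \<theta>) \<ge> 1" using th a1(1) by (simp add: field_simps)
    then have "- a \<le> x / \<theta>" "x / \<theta> \<le> 1"
      using th True a1 by (simp_all add: field_simps)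
    then have "prob (survival_event M X \<theta> n x) = (- 1) ^ n * appell_poly (1 / \<theta>) 1 n (x / \<theta>) / (1 + a) ^ n"
      by (rule Suc.IH)
    moreover have "\<theta> * x \<le> y \<longleftrightarrow> y / \<theta> \<le> x"
      using th by (simp add: field_simps)
    ultimately show ?thesis using True by (simp add: indicator_def)
  next
    case False
    then show ?thesis using Suc.prems by (auto simp: indicator_def)
  qed
  then show ?case
    using appell_poly_integral[OF Suc.prems(2), of "1 / \<theta>" 1 n] appell_poly_root[of "Suc n" "1 / \<theta>" 1]
    by (simp add: prob_survival_Suc mult.commute)
qed

end

section \<open>The persistence probabilities\<close>

theorem corollary7:
  fixes M :: "'b measure" and X :: "nat \<Rightarrow> 'b \<Rightarrow> real" and a \<theta> :: real
  assumes "prob_space M"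
    and "- 1 < a"
    and "prob_space.indep_vars M (\<lambda>_. borel) X {1..}"
    and "\<And>i. 1 \<le> i \<Longrightarrow>
           distributed M lborel (X i) (\<lambda>x. indicator {- a..1} x / measure lborel {- a..1})"
  shows "(1 \<le> \<theta> \<and> 0 \<le> a \<longrightarrow>
            (\<forall>n. persistence_prob M X n \<theta> =
               1 / (1 + a) ^ (n + 1) *
               (\<Sum>k=0..n + 1. phi (n + 1 - k) (1 / \<theta>) * (- a) ^ (n + 1 - k) *
                  ((1 / \<theta>) ^ (k * (k - 1) div 2) / fact k)))) \<and>
         (\<theta> < - 1 \<and> - 1 / \<theta> \<le> a \<and> a \<le> - \<theta> \<longrightarrow>
            (\<forall>n. persistence_prob M X n \<theta> =
               (- 1 / (1 + a)) ^ (n + 1) *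
               (\<Sum>k=0..n + 1. phi (n + 1 - k) (1 / \<theta>) *
                  ((1 / \<theta>) ^ (k * (k - 1) div 2) / fact k) * (- a) ^ k)))"
proof -
  interpret prob_space M by fact
  interpret uniform_sequence M X a
    using assms by unfold_locales
  let ?b = "1 / \<theta>"
  show ?thesis
  proof (intro conjI impI allI)
    fix n assume "1 \<le> \<theta> \<and> 0 \<le> a"
    then have th: "1 \<le> \<theta>" and a0: "0 \<le> a" by simp_all
    have "AE \<omega> in M. \<theta> * X (Suc n) \<omega> \<le> \<theta>"
      using AE_bounds[of "Suc n"] th by (auto elim!: eventually_mono)
    then have "persistence_prob M X n \<theta> = prob (survival_event M X \<theta> (Suc n) \<theta>)"
      by (rule persistence_prob_eq_survival[OF indep])
    also have "\<dots> = appell_poly ?b (- a) (Suc n) 1 / (1 + a) ^ Suc n"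
      using prob_survival_pos[OF th a0, of \<theta> "Suc n"] th a0 by simp
    finally show "persistence_prob M X n \<theta> = 1 / (1 + a) ^ (n + 1) *
        (\<Sum>k=0..n + 1. phi (n + 1 - k) ?b * (- a) ^ (n + 1 - k) * (?b ^ (k * (k - 1) div 2) / fact k))"
      by (simp add: appell_poly_def gauss_coeff_def)
  next
    fix n assume "\<theta> < - 1 \<and> - 1 / \<theta> \<le> a \<and> a \<le> - \<theta>"
    then have th: "\<theta> < - 1" and a1: "- 1 / \<theta> \<le> a" "a \<le> - \<theta>" by simp_all
    have "AE \<omega> in M. \<theta> * X (Suc n) \<omega> \<le> \<theta> * (- a)"
    proof (rule eventually_mono[OF AE_bounds])
      show "\<theta> * X (Suc n) \<omega> \<le> \<theta> * (- a)" if "- a \<le> X (Suc n) \<omega> \<and> X (Suc n) \<omega> \<le> 1" for \<omega>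
        using that th by (intro mult_left_mono_neg) auto
    qed simp
    then have "persistence_prob M X n \<theta> = prob (survival_event M X \<theta> (Suc n) (\<theta> * (- a)))"
      by (rule persistence_prob_eq_survival[OF indep])
    also have "\<dots> = (- 1) ^ Suc n * appell_poly ?b 1 (Suc n) (- a) / (1 + a) ^ Suc n"
      using prob_survival_neg[OF th a1, of "\<theta> * (- a)" "Suc n"] th minus_one_less by simp
    also have "\<dots> = (- 1 / (1 + a)) ^ Suc n * appell_poly ?b 1 (Suc n) (- a)"
      by (simp only: power_divide times_divide_eq_left)
    finally show "persistence_prob M X n \<theta> = (- 1 / (1 + a)) ^ (n + 1) *
        (\<Sum>k=0..n + 1. phi (n + 1 - k) ?b * (?b ^ (k * (k - 1) div 2) / fact k) * (- a) ^ k)"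
      by (simp only: appell_poly_def gauss_coeff_def Suc_eq_plus1 power_one mult_1_right)
  qed
qed

end
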